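(* Let $i$ and $k$ be integers with $1<i\leq k$. Then the function $g_k$ is unbounded on the class of graphs $H$ with $\chi(H)=i$, and the function $h_k$ is unbounded on the class of graphs $H$ with $\chi(H)=i$. That is, for every positive integer $N$ there is a graph $H$ with $\chi(H)=i$ and $g_k(H)\geq N$, and there is a graph $H'$ with $\chi(H')=i$ and $h_k(H')\geq N$.
   Context: For a graph $H$ and an integer $k\geq\chi(H)$, a proper $k$-coloring of $H$ is a map $\phi:V(H)\to[k]=\{1,\ldots,k\}$ with $\phi(u)\neq\phi(v)$ for every edge $uv$. For a positive integer $j$, the $j$-localized $k$-coloring graph $G^j_k(H)$ has as vertices the proper $k$-colorings of $H$, two distinct colorings being adjacent if $H$ contains a connected subgraph on at most $j$ vertices that contains every vertex on which the two colorings differ. The $k$-color mixing number $g_k(H)$ is the least positive integer $j$ such that $G^j_k(H)$ is connected, and the $k$-color Gray code number $h_k(H)$ is the least positive integer $j$ such that $G^j_k(H)$ is Hamiltonian (complete graphs, including those on one or two vertices, are regarded as Hamiltonian). These exist whenever $k\geq\chi(H)$. *)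

theory Defs
  imports
    "Graph_Theory.Digraph_Component"
    "Graph_Theory.Pair_Digraph"
    "Graph_Theory.Kuratowski"
    "HOL-Library.FuncSet"
begin

text \<open>
  A finite simple graph is a \<^locale>\<open>pair_graph\<close>: each edge \<open>uv\<close> is represented by the
  two arcs \<open>(u, v)\<close> and \<open>(v, u)\<close>.
\<close>

text \<open>
  Colorings are extensional functions, so that two colorings are equal iff they agree on the
  vertices of \<open>H\<close>.
\<close>

definition proper_colorings :: "'a pair_pre_digraph \<Rightarrow> nat \<Rightarrow> ('a \<Rightarrow> nat) set" where
  "proper_colorings H k =
    {\<phi> \<in> pverts H \<rightarrow>\<^sub>E {1..k}. \<forall>(u, v) \<in> parcs H. \<phi> u \<noteq> \<phi> v}"

definition chromatic_number :: "'a pair_pre_digraph \<Rightarrow> nat" where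
  "chromatic_number H = (LEAST k. proper_colorings H k \<noteq> {})"

definition localized_adjacent ::
    "'a pair_pre_digraph \<Rightarrow> nat \<Rightarrow> ('a \<Rightarrow> nat) \<Rightarrow> ('a \<Rightarrow> nat) \<Rightarrow> bool" where
  "localized_adjacent H j \<phi> \<psi> \<longleftrightarrow> \<phi> \<noteq> \<psi> \<and>
    (\<exists>K. pair_graph K \<and> subgraph (with_proj K) (with_proj H) \<and>
      Digraph_Component.connected (with_proj K) \<and>
      card (pverts K) \<le> j \<and> {v \<in> pverts H. \<phi> v \<noteq> \<psi> v} \<subseteq> pverts K)"

definition coloring_graph ::
    "nat \<Rightarrow> nat \<Rightarrow> 'a pair_pre_digraph \<Rightarrow> ('a \<Rightarrow> nat) pair_pre_digraph" where
  "coloring_graph j k H =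
    \<lparr> pverts = proper_colorings H k,
      parcs = {(\<phi>, \<psi>). \<phi> \<in> proper_colorings H k \<and> \<psi> \<in> proper_colorings H k \<and>
        localized_adjacent H j \<phi> \<psi>} \<rparr>"

text \<open>
  The bound on the length excludes the closed walk \<open>u, v, u\<close> along a single edge, which
  \<^const>\<open>pre_digraph.cycle\<close> admits. The graphs on one and two vertices that count as
  Hamiltonian are covered by the first disjunct.
\<close>

definition hamiltonian :: "('a, 'b) pre_digraph \<Rightarrow> bool" where
  "hamiltonian G \<longleftrightarrow>
    (\<exists>n>0. complete_digraph n G) \<or>
    (\<exists>p. pre_digraph.cycle G p \<and> 3 \<le> length p \<and> tail G ` set p = verts G)"

text \<open>
  The next two numbers are meaningful for a finite simple graph \<open>H\<close> with
  \<open>chromatic_number H \<le> k\<close>, where a suitable \<open>j\<close> exists.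
\<close>

definition mixing_number :: "nat \<Rightarrow> 'a pair_pre_digraph \<Rightarrow> nat" where
  "mixing_number k H =
    (LEAST j. 0 < j \<and> Digraph_Component.connected (with_proj (coloring_graph j k H)))"

definition gray_code_number :: "nat \<Rightarrow> 'a pair_pre_digraph \<Rightarrow> nat" where
  "gray_code_number k H =
    (LEAST j. 0 < j \<and> hamiltonian (with_proj (coloring_graph j k H)))"

lemma localized_adjacent_sym:
  "localized_adjacent H j \<phi> \<psi> \<Longrightarrow> localized_adjacent H j \<psi> \<phi>"
proof -
  have "{v \<in> pverts H. \<phi> v \<noteq> \<psi> v} = {v \<in> pverts H. \<psi> v \<noteq> \<phi> v}" by auto
  then show "localized_adjacent H j \<phi> \<psi> \<Longrightarrow> localized_adjacent H j \<psi> \<phi>"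
    unfolding localized_adjacent_def by auto
qed

lemma finite_proper_colorings:
  "finite (pverts H) \<Longrightarrow> finite (proper_colorings H k)"
  unfolding proper_colorings_def by (simp add: finite_PiE)

lemma pair_graph_coloring_graph:
  assumes "pair_graph H"
  shows "pair_graph (coloring_graph j k H)"
proof -
  interpret pair_graph H by fact
  have fin: "finite (proper_colorings H k)"
    by (rule finite_proper_colorings) (rule pair_finite_verts)
  have "finite (parcs (coloring_graph j k H))"
    by (rule finite_subset[OF _ finite_cartesian_product[OF fin fin]])
       (auto simp: coloring_graph_def)
  moreover have "\<not> localized_adjacent H j \<phi> \<phi>" for \<phi>
    by (simp add: localized_adjacent_def)
  ultimately show ?thesis
    using fin by unfold_locales
       (auto simp: coloring_graph_def symmetric_def intro!: symI dest: localized_adjacent_sym)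
qed

end

theory Submission
  imports Defs "HOL-Library.Nat_Bijection"
begin

text \<open>
  Label each vertex with a part \<open>p v \<le> i\<close> and a color \<open>f v \<le> k\<close>, and join two vertices when
  both labels differ. Then \<open>p\<close> and \<open>f\<close> are proper colorings, and a vertex of every label
  \<open>(a, a)\<close> with \<open>a \<le> i\<close> gives a clique of size \<open>i\<close>, so the chromatic number is \<open>i\<close>. If every
  label is carried by \<open>N\<close> vertices, then a coloring that differs from \<open>f\<close> in fewer than \<open>N\<close>
  places still agrees with \<open>f\<close> on one vertex of each label; hence every vertex \<open>v\<close> still sees all
  colors other than \<open>f v\<close>, and the coloring is \<open>f\<close>. Thus \<open>f\<close> is isolated in the localized
  coloring graph for \<open>j < N\<close>. For \<open>k = 2\<close> the graph would be disconnected, and only the labels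
  \<open>(1, 1)\<close> and \<open>(2, 2)\<close> are used.
\<close>

section \<open>Isolated vertices obstruct connectivity and Hamiltonicity\<close>

lemma isolated_vertex_not_connected:
  assumes "u \<in> pverts G" "v \<in> pverts G" "u \<noteq> v"
    and isolated: "\<And>w. (u, w) \<notin> parcs G" "\<And>w. (w, u) \<notin> parcs G"
  shows "\<not> Digraph_Component.connected (with_proj G)"
proof
  assume "Digraph_Component.connected (with_proj G)"
  then have "u \<rightarrow>\<^sup>*\<^bsub>with_proj (mk_symmetric (with_proj G))\<^esub> v"
    using assms(1,2) by (auto simp: connected_def strongly_connected_def)
  \<comment> \<open>Connectivity refers to the symmetric closure, so the first step of a nonempty
    walk from \<open>u\<close> uses an arc of \<open>G\<close> in one of the two directions; both
    are excluded.\<close>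
  then have "(u, v) \<in> rtrancl_on (pverts G) (parcs (mk_symmetric (with_proj G)))"
    by (simp add: reachable_def)
  then show False
    by (cases rule: converse_rtrancl_on_cases)
       (use assms(3) isolated in \<open>auto simp: parcs_mk_symmetric\<close>)
qed

lemma isolated_vertex_not_hamiltonian:
  assumes "u \<in> pverts G" "v \<in> pverts G" "u \<noteq> v"
    and isolated: "\<And>w. (u, w) \<notin> parcs G"
  shows "\<not> hamiltonian (with_proj G)"
proof
  assume "hamiltonian (with_proj G)"
  then consider n where "complete_digraph n (with_proj G)"
    | c where "pre_digraph.cycle (with_proj G) c" "fst ` set c = pverts G"
    by (auto simp: hamiltonian_def)
  then show False
  proof cases
    case 1
    then show False
      using assms by (auto simp: complete_digraph_def)
  next
    case 2
    \<comment> \<open>The tails of the arcs in \<open>c\<close> exhaust the vertices, so one of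
      these arcs would leave \<open>u\<close>.\<close>
    then have "set c \<subseteq> parcs G"
      by (auto simp: pre_digraph.cycle_def pre_digraph.awalk_def)
    with 2 assms(1) isolated show False by force
  qed
qed

section \<open>Completeness of the coloring graph at the largest radius\<close>

lemma complete_digraph_imp_connected:
  assumes "complete_digraph n G" "0 < n"
  shows "Digraph_Component.connected G"
proof -
  interpret graph G using assms(1) by (simp add: complete_digraph_def)
  show ?thesis
  proof (rule connectedI)
    show "verts G \<noteq> {}" using assms by (auto simp: complete_digraph_def)
    fix u v assume "u \<in> verts G" "v \<in> verts G"
    then have "u \<rightarrow>\<^sup>*\<^bsub>G\<^esub> v"
      using assms(1) by (cases "u = v") (auto simp: complete_digraph_def)
    then show "u \<rightarrow>\<^sup>*\<^bsub>with_proj (mk_symmetric G)\<^esub> v"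
      by (rule reachable_mk_symmetricI)
  qed
qed

text \<open>The connected graph \<open>H\<close> itself is a subgraph that covers every possible set
  of differences. Once a coloring exists, this gives an index at which the conditions minimized in
  both numbers hold.\<close>

lemma coloring_graph_complete:
  assumes "pair_graph H" "Digraph_Component.connected (with_proj H)"
  shows "complete_digraph (card (proper_colorings H k))
    (with_proj (coloring_graph (card (pverts H)) k H))"
proof -
  interpret pair_graph H by fact
  have "subgraph (with_proj H) (with_proj H)"
    by (auto simp: subgraph_def wf_digraph_axioms)
  then have "localized_adjacent H (card (pverts H)) \<phi> \<psi>" if "\<phi> \<noteq> \<psi>" for \<phi> \<psi> :: "'a \<Rightarrow> nat"
    using that assms unfolding localized_adjacent_def by (intro conjI exI[of _ H]) auto
  moreover have "\<not> localized_adjacent H j \<phi> \<phi>" for j \<phi>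
    by (simp add: localized_adjacent_def)
  moreover have "finite (proper_colorings H k)"
    by (intro finite_proper_colorings pair_finite_verts)
  ultimately show ?thesis
    by (auto simp: complete_digraph_pair_def coloring_graph_def)
qed

section \<open>Lower bounds from a rigid coloring\<close>

lemma localized_adjacent_card_le:
  assumes "localized_adjacent H j \<phi> \<psi>"
  shows "card {v \<in> pverts H. \<phi> v \<noteq> \<psi> v} \<le> j"
proof -
  obtain K where K: "pair_graph K" "card (pverts K) \<le> j"
    "{v \<in> pverts H. \<phi> v \<noteq> \<psi> v} \<subseteq> pverts K"
    using assms by (auto simp: localized_adjacent_def)
  have "finite (pverts K)"
    using K(1) pair_fin_digraph.pair_finite_verts pair_graph_def pair_digraph_def by blast
  then show ?thesis using card_mono[OF _ K(3)] K(2) by linarith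
qed

text \<open>For \<open>j < N\<close> the coloring \<open>\<phi>\<close> has no neighbor. The second
  coloring \<open>\<psi>\<close> rules out the one-vertex coloring graph, which would be connected
  and Hamiltonian.\<close>

lemma rigid_coloring_bounds:
  assumes H: "pair_graph H" "Digraph_Component.connected (with_proj H)"
    and \<phi>: "\<phi> \<in> proper_colorings H k" and \<psi>: "\<psi> \<in> proper_colorings H k" "\<phi> \<noteq> \<psi>"
    and rigid: "\<And>\<chi>. \<chi> \<in> proper_colorings H k \<Longrightarrow> \<chi> \<noteq> \<phi> \<Longrightarrow>
      N \<le> card {v \<in> pverts H. \<phi> v \<noteq> \<chi> v}"
  shows "N \<le> mixing_number k H" and "N \<le> gray_code_number k H"
proof -
  interpret pair_graph H by fact
  have isolated: "(\<phi>, \<chi>) \<notin> parcs (coloring_graph j k H)" "(\<chi>, \<phi>) \<notin> parcs (coloring_graph j k H)"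
    if "j < N" for j \<chi>
  proof -
    have "\<not> localized_adjacent H j \<phi> \<chi>" if "\<chi> \<in> proper_colorings H k"
    proof
      assume adj: "localized_adjacent H j \<phi> \<chi>"
      then have "\<chi> \<noteq> \<phi>" by (auto simp: localized_adjacent_def)
      with rigid that localized_adjacent_card_le[OF adj] \<open>j < N\<close> show False by fastforce
    qed
    then show "(\<phi>, \<chi>) \<notin> parcs (coloring_graph j k H)"
      by (auto simp: coloring_graph_def)
    then show "(\<chi>, \<phi>) \<notin> parcs (coloring_graph j k H)"
      using localized_adjacent_sym by (auto simp: coloring_graph_def)
  qed
  have mem: "\<phi> \<in> pverts (coloring_graph j k H)" "\<psi> \<in> pverts (coloring_graph j k H)" for j
    using \<phi> \<psi>(1) by (simp_all add: coloring_graph_def)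
  define n where "n = card (proper_colorings H k)"
  have "finite (proper_colorings H k)"
    by (intro finite_proper_colorings pair_finite_verts)
  then have "0 < n" using \<phi> by (auto simp: n_def card_gt_0_iff)
  have "pverts H \<noteq> {}"
    using H(2) by (auto simp: connected_def strongly_connected_def)
  then have pos: "0 < card (pverts H)" by (simp add: card_gt_0_iff pair_finite_verts)
  have complete: "complete_digraph n (with_proj (coloring_graph (card (pverts H)) k H))"
    unfolding n_def by (rule coloring_graph_complete[OF H])
  \<comment> \<open>The least index has the required property only because some index does:
    \<open>card (pverts H)\<close> is positive and gives a complete graph.\<close>
  have "Digraph_Component.connected (with_proj (coloring_graph (mixing_number k H) k H))"
    unfolding mixing_number_def
    by (rule LeastI2[of _ "card (pverts H)"])
       (use pos complete_digraph_imp_connected[OF complete \<open>0 < n\<close>] in auto)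
  then show "N \<le> mixing_number k H"
    using isolated_vertex_not_connected[OF mem \<psi>(2) isolated] not_le by blast
  have "hamiltonian (with_proj (coloring_graph (gray_code_number k H) k H))"
    unfolding gray_code_number_def
    by (rule LeastI2[of _ "card (pverts H)"])
       (use pos complete \<open>0 < n\<close> in \<open>auto simp: hamiltonian_def\<close>)
  then show "N \<le> gray_code_number k H"
    using isolated_vertex_not_hamiltonian[OF mem \<psi>(2) isolated(1)] not_le by blast
qed

section \<open>Graphs defined by two labels and their colorings\<close>

text \<open>A blow-up of an induced subgraph of the tensor product of two complete graphs: each
  label pair that occurs is replaced by the independent set of vertices carrying it.\<close>

definition two_label_graph :: "'a set \<Rightarrow> ('a \<Rightarrow> nat) \<Rightarrow> ('a \<Rightarrow> nat) \<Rightarrow> 'a pair_pre_digraph" where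
  "two_label_graph V p f =
    \<lparr> pverts = V, parcs = {(u, v). u \<in> V \<and> v \<in> V \<and> p u \<noteq> p v \<and> f u \<noteq> f v} \<rparr>"

lemma pverts_two_label_graph [simp]: "pverts (two_label_graph V p f) = V"
  by (simp add: two_label_graph_def)

lemma parcs_two_label_graph [simp]:
  "(u, v) \<in> parcs (two_label_graph V p f) \<longleftrightarrow> u \<in> V \<and> v \<in> V \<and> p u \<noteq> p v \<and> f u \<noteq> f v"
  by (simp add: two_label_graph_def)

lemma pair_graph_two_label_graph:
  assumes "finite V"
  shows "pair_graph (two_label_graph V p f)"
proof -
  have "finite (parcs (two_label_graph V p f))"
    by (rule finite_subset[OF _ finite_cartesian_product[OF assms assms]]) auto
  then show ?thesis
    using assms by unfold_locales (auto simp: two_label_graph_def symmetric_def intro!: symI)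
qed

lemma proper_colorings_two_label_graph_iff:
  "\<phi> \<in> proper_colorings (two_label_graph V p f) m \<longleftrightarrow> \<phi> \<in> V \<rightarrow>\<^sub>E {1..m} \<and>
    (\<forall>u\<in>V. \<forall>v\<in>V. p u \<noteq> p v \<longrightarrow> f u \<noteq> f v \<longrightarrow> \<phi> u \<noteq> \<phi> v)"
  by (auto simp: proper_colorings_def two_label_graph_def)

lemma chromatic_number_two_label_graph:
  assumes "p \<in> V \<rightarrow> {1..i}" and diag: "\<And>a. a \<in> {1..i} \<Longrightarrow> \<exists>v\<in>V. p v = a \<and> f v = a"
  shows "chromatic_number (two_label_graph V p f) = i"
  unfolding chromatic_number_def
proof (rule Least_equality)
  have "restrict p V \<in> proper_colorings (two_label_graph V p f) i"
    using assms(1) by (auto simp: proper_colorings_two_label_graph_iff)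
  then show "proper_colorings (two_label_graph V p f) i \<noteq> {}" by blast
next
  fix m assume "proper_colorings (two_label_graph V p f) m \<noteq> {}"
  then obtain \<phi> where \<phi>: "\<phi> \<in> V \<rightarrow>\<^sub>E {1..m}"
    "\<And>u v. u \<in> V \<Longrightarrow> v \<in> V \<Longrightarrow> p u \<noteq> p v \<Longrightarrow> f u \<noteq> f v \<Longrightarrow> \<phi> u \<noteq> \<phi> v"
    unfolding ex_in_conv[symmetric] proper_colorings_two_label_graph_iff by blast
  \<comment> \<open>The vertices \<open>w a\<close> form a clique, as distinct diagonal labels
    differ in both entries; hence \<open>\<phi>\<close> is injective on them.\<close>
  obtain w where w: "\<And>a. a \<in> {1..i} \<Longrightarrow> w a \<in> V \<and> p (w a) = a \<and> f (w a) = a"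
    using diag by metis
  have "inj_on (\<lambda>a. \<phi> (w a)) {1..i}"
    by (rule inj_onI) (metis \<phi>(2) w)
  moreover have "(\<lambda>a. \<phi> (w a)) ` {1..i} \<subseteq> {1..m}"
    using \<phi>(1) w by blast
  ultimately have "card {1..i} \<le> card {1..m}" by (intro card_inj_on_le) auto
  then show "i \<le> m" by simp
qed

lemma two_label_coloring_rigid:
  assumes "finite V"
    and rich: "\<And>v c. v \<in> V \<Longrightarrow> c \<in> {1..k} \<Longrightarrow> c \<noteq> f v \<Longrightarrow>
      N \<le> card {u \<in> V. p u \<noteq> p v \<and> f u = c}"
    and \<chi>: "\<chi> \<in> proper_colorings (two_label_graph V p f) k" "\<chi> \<noteq> restrict f V"
  shows "N \<le> card {v \<in> V. restrict f V v \<noteq> \<chi> v}"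
proof (rule ccontr)
  let ?D = "{v \<in> V. restrict f V v \<noteq> \<chi> v}"
  assume less: "\<not> N \<le> card ?D"
  have \<chi>': "\<chi> \<in> V \<rightarrow>\<^sub>E {1..k}"
    "\<And>u v. u \<in> V \<Longrightarrow> v \<in> V \<Longrightarrow> p u \<noteq> p v \<Longrightarrow> f u \<noteq> f v \<Longrightarrow> \<chi> u \<noteq> \<chi> v"
    using \<chi>(1) by (auto simp: proper_colorings_two_label_graph_iff)
  have "\<chi> v = f v" if v: "v \<in> V" for v
  proof (rule ccontr)
    assume neq: "\<chi> v \<noteq> f v"
    \<comment> \<open>Vertices with \<open>f\<close>-color \<open>\<chi> v\<close> outside the part
      of \<open>v\<close> are neighbors of \<open>v\<close>, because \<open>\<chi> v\<close> differs
      from \<open>f v\<close>. There are at least \<open>N\<close> of them and fewer than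
      \<open>N\<close> recolored vertices, so one keeps its color and clashes with
      \<open>v\<close>.\<close>
    have "\<chi> v \<in> {1..k}" using \<chi>'(1) v by blast
    then have "N \<le> card {u \<in> V. p u \<noteq> p v \<and> f u = \<chi> v}"
      using rich v neq by blast
    moreover have "finite ?D" using assms(1) by simp
    ultimately have "\<not> {u \<in> V. p u \<noteq> p v \<and> f u = \<chi> v} \<subseteq> ?D"
      using less card_mono order_trans by blast
    then obtain u where u: "u \<in> V" "p u \<noteq> p v" "f u = \<chi> v" "restrict f V u = \<chi> u"
      by blast
    then have "\<chi> u = f u" by simp
    with u \<chi>'(2)[of u v] v neq show False by simp
  qed
  then have "\<chi> = restrict f V"
    using \<chi>'(1) by (intro extensionalityI[of _ V]) (auto simp: PiE_def)
  with \<chi>(2) show False by simp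
qed

lemma two_label_graph_bounds:
  fixes V :: "'a set"
  defines "H p f \<equiv> two_label_graph V p f"
  assumes "finite V" "f \<in> V \<rightarrow> {1..k}" "v0 \<in> V" "f v0 = 1" "2 \<le> k"
    and "Digraph_Component.connected (with_proj (H p f))"
    and "\<And>v c. v \<in> V \<Longrightarrow> c \<in> {1..k} \<Longrightarrow> c \<noteq> f v \<Longrightarrow>
      N \<le> card {u \<in> V. p u \<noteq> p v \<and> f u = c}"
  shows "N \<le> mixing_number k (H p f)" and "N \<le> gray_code_number k (H p f)"
proof -
  \<comment> \<open>Swapping colors 1 and 2 preserves properness and changes \<open>f\<close> at
    \<open>v0\<close>, which yields the second coloring.\<close>
  let ?s = "\<lambda>c::nat. if c = 1 then 2 else if c = 2 then 1 else c"
  have f: "restrict f V \<in> proper_colorings (H p f) k"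
    using assms(3) by (auto simp: H_def proper_colorings_two_label_graph_iff)
  have s: "restrict (\<lambda>v. ?s (f v)) V \<in> proper_colorings (H p f) k"
  proof -
    have "?s (f v) \<in> {1..k}" if "v \<in> V" for v
      using assms(3,6) that by (auto simp: Pi_iff)
    then show ?thesis
      unfolding H_def proper_colorings_two_label_graph_iff by auto
  qed
  have neq: "restrict f V \<noteq> restrict (\<lambda>v. ?s (f v)) V"
  proof
    assume "restrict f V = restrict (\<lambda>v. ?s (f v)) V"
    from fun_cong[OF this, of v0] show False using assms(4,5) by simp
  qed
  have G: "pair_graph (H p f)"
    unfolding H_def by (rule pair_graph_two_label_graph[OF assms(2)])
  have rigid: "N \<le> card {v \<in> pverts (H p f). restrict f V v \<noteq> \<chi> v}"
    if "\<chi> \<in> proper_colorings (H p f) k" "\<chi> \<noteq> restrict f V" for \<chi>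
    using two_label_coloring_rigid[OF assms(2,8) that[unfolded H_def]]
    unfolding H_def pverts_two_label_graph .
  show "N \<le> mixing_number k (H p f)" "N \<le> gray_code_number k (H p f)"
    by (rule rigid_coloring_bounds[OF G assms(7) f s neq rigid]; assumption)+
qed

section \<open>Choice of labels, richness and connectivity\<close>

lemma two_label_graph_exists:
  fixes i k N :: nat
  assumes "1 < i" "i \<le> k" "0 < N"
  obtains V :: "nat set" and p f where
    "finite V" "p \<in> V \<rightarrow> {1..i}" "f \<in> V \<rightarrow> {1..k}"
    "\<And>a. a \<in> {1..i} \<Longrightarrow> \<exists>v\<in>V. p v = a \<and> f v = a"
    "\<And>v c. v \<in> V \<Longrightarrow> c \<in> {1..k} \<Longrightarrow> c \<noteq> f v \<Longrightarrow> N \<le> card {u \<in> V. p u \<noteq> p v \<and> f u = c}"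
    "Digraph_Component.connected (with_proj (two_label_graph V p f))"
proof
  \<comment> \<open>A vertex encodes its part \<open>a\<close>, its color \<open>c\<close> and a
    copy number \<open>t\<close>.\<close>
  define enc where "enc a c t = prod_encode (a, prod_encode (c, t))" for a c t
  define p where "p v = fst (prod_decode v)" for v
  define f where "f v = fst (prod_decode (snd (prod_decode v)))" for v
  \<comment> \<open>If \<open>3 \<le> k\<close> fails, then \<open>i = k = 2\<close> and
    \<open>W\<close> consists of \<open>(1, 1)\<close> and \<open>(2, 2)\<close>; otherwise all
    labels are allowed.\<close>
  define W where "W = {(a, c). a \<in> {1..i} \<and> c \<in> {1..k} \<and> (a = c \<or> 3 \<le> k)}"
  define V where "V = (\<lambda>((a, c), t). enc a c t) ` (W \<times> {1..N})"
  have [simp]: "p (enc a c t) = a" "f (enc a c t) = c" for a c t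
    by (simp_all add: enc_def p_def f_def)
  have enc_inj: "t = t'" if "enc a c t = enc a c t'" for a c t t'
    using that by (simp add: enc_def)
  have enc_in: "enc a c t \<in> V" if "(a, c) \<in> W" "t \<in> {1..N}" for a c t
    using that by (auto simp: V_def intro!: image_eqI[where x = "((a, c), t)"])
  have V_cases: "(p v, f v) \<in> W" if "v \<in> V" for v
    using that by (auto simp: V_def)
  have "finite W"
    by (rule finite_subset[of _ "{1..i} \<times> {1..k}"]) (auto simp: W_def)
  then show "finite V" by (simp add: V_def)
  show "p \<in> V \<rightarrow> {1..i}" "f \<in> V \<rightarrow> {1..k}"
    using V_cases by (fastforce simp: W_def)+
  have diag: "enc a a 1 \<in> V" if "a \<in> {1..i}" for a
    using that assms by (intro enc_in) (auto simp: W_def)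
  then show "\<exists>v\<in>V. p v = a \<and> f v = a" if "a \<in> {1..i}" for a
    using that by (intro bexI[of _ "enc a a 1"]) auto
  show "N \<le> card {u \<in> V. p u \<noteq> p v \<and> f u = c}" if v: "v \<in> V" "c \<in> {1..k}" "c \<noteq> f v" for v c
  proof -
    \<comment> \<open>A single label \<open>(b, c)\<close> in another part suffices, since its
      \<open>N\<close> copies give the count. In the diagonal case \<open>p v = f v\<close>, so the
      part \<open>c\<close> differs from that of \<open>v\<close>.\<close>
    obtain b where b: "(b, c) \<in> W" "b \<noteq> p v"
    proof (cases "3 \<le> k")
      case True
      then have "(if p v = 1 then 2 else 1, c) \<in> W" using v(2) assms by (auto simp: W_def)
      moreover have "(if p v = 1 then 2 else 1) \<noteq> p v" by simp
      ultimately show ?thesis by (rule that)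
    next
      case False
      then have "i = k" using assms by simp
      with False V_cases[OF v(1)] v(2,3) have "(c, c) \<in> W" "c \<noteq> p v" by (auto simp: W_def)
      then show ?thesis using that by blast
    qed
    have "enc b c ` {1..N} \<subseteq> {u \<in> V. p u \<noteq> p v \<and> f u = c}"
      using b enc_in by auto
    moreover have "card (enc b c ` {1..N}) = N"
      by (subst card_image) (auto intro: inj_onI enc_inj)
    moreover have "finite {u \<in> V. p u \<noteq> p v \<and> f u = c}" using \<open>finite V\<close> by simp
    ultimately show ?thesis using card_mono by metis
  qed
  let ?H = "two_label_graph V p f"
  interpret pair_graph ?H using \<open>finite V\<close> by (rule pair_graph_two_label_graph)
  have adj: "u \<rightarrow>\<^sup>*\<^bsub>with_proj ?H\<^esub> v" if "u \<in> V" "v \<in> V" "p u \<noteq> p v" "f u \<noteq> f v" for u v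
    using that by (intro reachable_adjI) simp
  \<comment> \<open>The route is from \<open>v\<close> through \<open>(b, c)\<close> and
    \<open>(p v, p v)\<close> to \<open>(1, 1)\<close>, with both labels changing at each step; the
    last step is void if \<open>p v = 1\<close>.\<close>
  have root: "v \<rightarrow>\<^sup>*\<^bsub>with_proj ?H\<^esub> enc 1 1 1" if v: "v \<in> V" for v
  proof -
    have W: "(p v, f v) \<in> W" using V_cases v .
    then have pv: "p v \<in> {1..i}" by (auto simp: W_def)
    define b where "b = (if p v = 1 then 2 else 1 :: nat)"
    \<comment> \<open>The color \<open>c\<close> must avoid \<open>f v\<close> for the first step
      and \<open>p v\<close> for the second. Three colors always leave such a choice; in the
      diagonal case the two forbidden values coincide.\<close>
    obtain c where c: "(b, c) \<in> W" "c \<noteq> p v" "c \<noteq> f v"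
    proof (cases "3 \<le> k")
      case True
      have "card {p v, f v} < card {1..3::nat}" by (simp add: card_insert_if)
      then have "\<not> {1..3} \<subseteq> {p v, f v}" using card_mono[of "{p v, f v}" "{1..3}"] by auto
      then obtain c where "c \<in> {1..3}" "c \<noteq> p v" "c \<noteq> f v" by blast
      moreover from this have "(b, c) \<in> W" using True assms by (auto simp: W_def b_def)
      ultimately show ?thesis using that by blast
    next
      case False
      then have "(b, b) \<in> W" "b \<noteq> p v" "b \<noteq> f v"
        using W assms by (auto simp: W_def b_def)
      then show ?thesis using that by blast
    qed
    have "b \<noteq> p v" by (simp add: b_def)
    have bc: "enc b c 1 \<in> V" using c(1) assms(3) by (intro enc_in) auto
    then have "v \<rightarrow>\<^sup>*\<^bsub>with_proj ?H\<^esub> enc b c 1" using bc c v \<open>b \<noteq> p v\<close> by (intro adj) auto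
    also have "enc b c 1 \<rightarrow>\<^sup>*\<^bsub>with_proj ?H\<^esub> enc (p v) (p v) 1"
      using bc c \<open>b \<noteq> p v\<close> diag[OF pv] by (intro adj) auto
    also have "enc (p v) (p v) 1 \<rightarrow>\<^sup>*\<^bsub>with_proj ?H\<^esub> enc 1 1 1"
    proof (cases "p v = 1")
      case True
      then show ?thesis using diag[OF pv] by simp
    next
      case False
      then show ?thesis using diag[OF pv] diag[of 1] assms(1) by (intro adj) auto
    qed
    finally show ?thesis .
  qed
  show "Digraph_Component.connected (with_proj ?H)"
  proof (rule connectedI)
    show "pverts ?H \<noteq> {}" using diag[of 1] assms by auto
    \<comment> \<open>Two vertices are joined through the root, the second half being reversed by
      symmetry of the arcs.\<close>
    fix u v assume "u \<in> pverts ?H" "v \<in> pverts ?H"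
    then have "u \<rightarrow>\<^sup>*\<^bsub>with_proj ?H\<^esub> enc 1 1 1" "enc 1 1 1 \<rightarrow>\<^sup>*\<^bsub>with_proj ?H\<^esub> v"
      using root symmetric_reachable[OF pair_sym_arcs] by auto
    then have "u \<rightarrow>\<^sup>*\<^bsub>with_proj ?H\<^esub> v" by (rule reachable_trans)
    then show "u \<rightarrow>\<^sup>*\<^bsub>with_proj (mk_symmetric (with_proj ?H))\<^esub> v"
      by (rule reachable_mk_symmetricI)
  qed
qed

theorem mainTheorem1:
  fixes i k :: nat
  assumes "1 < i" and "i \<le> k"
  shows "\<forall>N>0.
    (\<exists>H :: nat pair_pre_digraph.
      pair_graph H \<and> chromatic_number H = i \<and> N \<le> mixing_number k H) \<and>
    (\<exists>H' :: nat pair_pre_digraph.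
      pair_graph H' \<and> chromatic_number H' = i \<and> N \<le> gray_code_number k H')"
proof (intro allI impI)
  fix N :: nat assume "0 < N"
  show "(\<exists>H :: nat pair_pre_digraph.
      pair_graph H \<and> chromatic_number H = i \<and> N \<le> mixing_number k H) \<and>
    (\<exists>H' :: nat pair_pre_digraph.
      pair_graph H' \<and> chromatic_number H' = i \<and> N \<le> gray_code_number k H')"
  proof (rule two_label_graph_exists[OF assms \<open>0 < N\<close>])
    fix V :: "nat set" and p f
    assume V: "finite V" "p \<in> V \<rightarrow> {1..i}" "f \<in> V \<rightarrow> {1..k}"
      "\<And>a. a \<in> {1..i} \<Longrightarrow> \<exists>v\<in>V. p v = a \<and> f v = a"
      "\<And>v c. v \<in> V \<Longrightarrow> c \<in> {1..k} \<Longrightarrow> c \<noteq> f v \<Longrightarrow> N \<le> card {u \<in> V. p u \<noteq> p v \<and> f u = c}"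
      "Digraph_Component.connected (with_proj (two_label_graph V p f))"
    \<comment> \<open>The diagonal label \<open>(1, 1)\<close> provides a vertex of color 1, at
      which the color swap is visible.\<close>
    obtain v0 where v0: "v0 \<in> V" "f v0 = 1" using V(4)[of 1] assms by auto
    have "2 \<le> k" using assms by simp
    have "N \<le> mixing_number k (two_label_graph V p f)"
      "N \<le> gray_code_number k (two_label_graph V p f)"
      by (rule two_label_graph_bounds[OF V(1,3) v0 \<open>2 \<le> k\<close> V(6,5)]; assumption)+
    moreover have "chromatic_number (two_label_graph V p f) = i"
      using V(2,4) by (rule chromatic_number_two_label_graph)
    \<comment> \<open>The same graph serves as witness for both numbers.\<close>
    ultimately show ?thesis
      using pair_graph_two_label_graph[OF V(1)] by blast
  qed
qed

end
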